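(* Let $\{L_k\}_{k=1}^n$ and $\{M_k\}_{k=1}^m$ be two collections of indicator random variables (not assumed independent) with $\mathbb{E}[L_k]=p_k$ for $k=1,\dots,n$ and $\mathbb{E}[M_k]=q_k$ for $k=1,\dots,m$, and let $$U=\sum_{k=1}^n L_k-\sum_{k=1}^m M_k .$$ Let $U_k^{(L)}$ ($k=1,\dots,n$) and $U_k^{(M)}$ ($k=1,\dots,m$) be random variables, all defined on a common probability space with $U$, such that $$\mathcal{L}\left(U_k^{(L)}+1\right)=\mathcal{L}(U\mid L_k=1),\ k=1,\dots,n,\qquad \mathcal{L}\left(U_k^{(M)}-1\right)=\mathcal{L}(U\mid M_k=1),\ k=1,\dots,m.$$ If $\lambda_1=\sum_{k=1}^n p_k$, $\lambda_2=\sum_{k=1}^m q_k$ and $W\sim\mathrm{Skellam}(\lambda_1,\lambda_2)$, then $$d_{KS}(U,W)\le \|\Delta f\|\left\{\sum_{k=1}^n p_k\,\mathbb{E}\left|U-U_k^{(L)}\right|+\sum_{k=1}^m q_k\,\mathbb{E}\left|U-U_k^{(M)}\right|\right\},$$ where $$\|\Delta f\|=\sup_{x\in\mathbb{R}}\sup_{j\in\mathbb{Z}}|f_x(j+1)-f_x(j)|$$ and, for each $x\in\mathbb{R}$, $f_x:\mathbb{Z}\to\mathbb{R}$ is a solution of $$\lambda_1 f_x(k+1)-k f_x(k)-\lambda_2 f_x(k-1)=1\{k\le x\}-\mathbb{P}(W\le x),\qquad k\in\mathbb{Z}.$$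
   Context: $\mathcal{L}(X)$ denotes the law of $X$, and $\mathcal{L}(X\mid A)$ its conditional law given the event $A$. The Kolmogorov–Smirnov distance is $d_{KS}(X_1,X_2)=\sup_{x\in\mathbb{R}}|\mathbb{P}(X_1\le x)-\mathbb{P}(X_2\le x)|$. For $\lambda_1,\lambda_2>0$, $W\sim\mathrm{Skellam}(\lambda_1,\lambda_2)$ means that $W$ has the law of the difference of two independent Poisson random variables with means $\lambda_1$ and $\lambda_2$; equivalently $\mathbb{P}(W=k)=e^{-(\lambda_1+\lambda_2)}(\sqrt{\lambda_1/\lambda_2})^kI_k(2\sqrt{\lambda_1\lambda_2})$, $k\in\mathbb{Z}$, with $I_k$ the modified Bessel function of the first kind. It is understood that $\lambda_1,\lambda_2>0$. *)

theory Defs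
  imports "HOL-Probability.Probability"
begin

definition ks_dist :: "'a measure \<Rightarrow> ('a \<Rightarrow> real) \<Rightarrow> 'b measure \<Rightarrow> ('b \<Rightarrow> real) \<Rightarrow> real" where
  "ks_dist M X N Y =
     (SUP x::real. \<bar>measure M {\<omega> \<in> space M. X \<omega> \<le> x} - measure N {\<omega> \<in> space N. Y \<omega> \<le> x}\<bar>)"

text \<open>\<^const>\<open>uniform_measure\<close> \<open>M A\<close> is the conditional probability measure
  \<open>B \<mapsto> M (A \<inter> B) / M A\<close>. It is a probability measure only if \<open>A\<close> has positive probability.\<close>

definition cond_law :: "'a measure \<Rightarrow> ('a \<Rightarrow> real) \<Rightarrow> 'a set \<Rightarrow> real measure" where
  "cond_law M X A = distr (uniform_measure M A) borel X"

text \<open>\<^const>\<open>poisson_pmf\<close> is specified only for positive rates, so \<open>skellam_pmf\<close>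
  is meaningful only for positive parameters.\<close>

definition skellam_pmf :: "real \<Rightarrow> real \<Rightarrow> int pmf" where
  "skellam_pmf l1 l2 =
     map_pmf (\<lambda>(a, b). int a - int b) (pair_pmf (poisson_pmf l1) (poisson_pmf l2))"

definition skellam_distributed :: "'a measure \<Rightarrow> ('a \<Rightarrow> real) \<Rightarrow> real \<Rightarrow> real \<Rightarrow> bool" where
  "skellam_distributed M W l1 l2 \<longleftrightarrow>
     W \<in> borel_measurable M \<and>
     distr M borel W = distr (measure_pmf (skellam_pmf l1 l2)) borel real_of_int"

text \<open>The supremum is taken in \<^typ>\<open>ennreal\<close> because it is infinite for some families \<open>f\<close>.\<close>

definition diff_norm :: "(real \<Rightarrow> int \<Rightarrow> real) \<Rightarrow> ennreal" where
  "diff_norm f = (SUP x. SUP j. ennreal \<bar>f x (j + 1) - f x j\<bar>)"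

end

theory Submission
  imports Defs
begin

text \<open>The proof is Stein's method. Evaluating the equation for \<open>f x\<close> at \<open>U\<close> and taking expectations
  expresses the difference of the two distribution functions at \<open>x\<close>, with \<open>g = f x\<close>, as
  \<open>E [l1 * g (U + 1) - U * g U - l2 * g (U - 1)]\<close>. Write \<open>U * g U\<close> as the sum of the
  \<open>L k * g U\<close> minus the sum of the \<open>M k * g U\<close>. Averaging against an indicator is, up to its
  probability, averaging under the conditional law, so
  \<open>E [L k * g U] = p k * E [g (UL k + 1)]\<close> and \<open>E [M k * g U] = q k * E [g (UM k - 1)]\<close>
  (lemma \<open>expectation_against_indicator\<close>). Since \<open>l1\<close> and \<open>l2\<close> are the sums of the \<open>p k\<close> and the
  \<open>q k\<close>, the whole expression splits into the terms \<open>p k * E [g (U + 1) - g (UL k + 1)]\<close> minus the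
  terms \<open>q k * E [g (U - 1) - g (UM k - 1)]\<close>. All arguments are integers, so each difference of
  values of \<open>g\<close> is at most the largest increment of \<open>g\<close> times the distance of the arguments
  (lemma \<open>increments_bound_differences\<close>); this is \<open>coupling_bound\<close>.

  The estimates are carried out in \<^typ>\<open>ennreal\<close>, where \<open>\<infinity> * 0 = 0\<close>. They therefore also cover
  the case that the increments of \<open>f\<close> are unbounded: if the distances vanish, so do the differences.
  The function \<open>g\<close> lives on the integers and the random variables are real, hence the floor
  functions.\<close>

lemma increments_bound_differences:
  fixes F :: "int \<Rightarrow> real"
  assumes D: "\<And>j. ennreal \<bar>F (j + 1) - F j\<bar> \<le> D"
  shows "ennreal \<bar>F a - F b\<bar> \<le> D * ennreal \<bar>of_int a - of_int b\<bar>"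
proof -
  have up: "ennreal \<bar>F (b + int i) - F b\<bar> \<le> D * ennreal (real i)" for b i
  proof (induction i)
    case 0
    then show ?case by simp
  next
    case (Suc i)
    have ennreal_Suc: "ennreal (1 + real i) = 1 + ennreal (real i)"
      by simp
    have "ennreal \<bar>F (b + int (Suc i)) - F b\<bar>
        \<le> ennreal (\<bar>F ((b + int i) + 1) - F (b + int i)\<bar> + \<bar>F (b + int i) - F b\<bar>)"
      by (rule ennreal_leI) (simp add: add.assoc add.commute[of 1])
    also have "\<dots> = ennreal \<bar>F ((b + int i) + 1) - F (b + int i)\<bar> + ennreal \<bar>F (b + int i) - F b\<bar>"
      by simp
    also have "\<dots> \<le> D + D * ennreal (real i)"
      by (rule add_mono[OF D Suc.IH])
    also have "\<dots> = D * ennreal (real (Suc i))"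
      by (simp add: distrib_left ennreal_Suc)
    finally show ?case .
  qed
  show ?thesis
  proof (cases "b \<le> a")
    case True
    then show ?thesis using up[of b "nat (a - b)"] by simp
  next
    case False
    then show ?thesis using up[of a "nat (b - a)"] by (simp add: abs_minus_commute)
  qed
qed

lemma (in prob_space) emeasure_indicator_event:
  assumes L: "L \<in> borel_measurable M" "\<And>\<omega>. \<omega> \<in> space M \<Longrightarrow> L \<omega> \<in> {0, 1::real}"
  shows "emeasure M {\<omega> \<in> space M. L \<omega> = 1} = ennreal (expectation L)"
proof -
  have "expectation L = expectation (indicator {\<omega> \<in> space M. L \<omega> = 1})"
    by (intro Bochner_Integration.integral_cong) (use L(2) in \<open>auto simp: indicator_def\<close>)
  then show ?thesis
    using L(1) by (simp add: emeasure_eq_measure)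
qed

text \<open>Conditioning on \<open>L = 1\<close> is the change of measure with density \<open>L / p\<close>, so integrating \<open>h\<close>
  against the conditional law of \<open>U\<close> is integrating \<open>L * h U / p\<close>.\<close>

lemma (in prob_space) expectation_against_indicator:
  fixes h :: "real \<Rightarrow> real"
  assumes L: "L \<in> borel_measurable M" "\<And>\<omega>. \<omega> \<in> space M \<Longrightarrow> L \<omega> \<in> {0, 1::real}"
    and p: "expectation L = p" "p > 0"
    and U [measurable]: "U \<in> borel_measurable M" and V [measurable]: "V \<in> borel_measurable M"
    and law: "distr M borel V = cond_law M U {\<omega> \<in> space M. L \<omega> = 1}"
    and h [measurable]: "h \<in> borel_measurable borel"
    and int: "integrable M (\<lambda>\<omega>. h (U \<omega>))"
  shows "integrable M (\<lambda>\<omega>. h (V \<omega>))"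
    and "expectation (\<lambda>\<omega>. L \<omega> * h (U \<omega>)) = p * expectation (\<lambda>\<omega>. h (V \<omega>))"
proof -
  define A where "A = {\<omega> \<in> space M. L \<omega> = 1}"
  have A [measurable]: "A \<in> sets M" using L(1) by (simp add: A_def)
  have "emeasure M A = ennreal p"
    using emeasure_indicator_event[OF L] p(1) by (simp add: A_def)
  then have uniform: "uniform_measure M A = density M (\<lambda>\<omega>. ennreal (indicator A \<omega> / p))"
    using p(2) unfolding uniform_measure_def
    by (intro density_cong) (auto simp: indicator_def divide_ennreal ennreal_1[symmetric] simp del: ennreal_1)
  have law': "distr M borel V = distr (density M (\<lambda>\<omega>. ennreal (indicator A \<omega> / p))) borel U"
    using law by (simp add: cond_law_def uniform flip: A_def)
  have "integrable M (\<lambda>\<omega>. indicator A \<omega> *\<^sub>R h (U \<omega>) / p)"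
    by (intro integrable_mult_indicator integrable_divide int A)
  then have "integrable (density M (\<lambda>\<omega>. ennreal (indicator A \<omega> / p))) (\<lambda>\<omega>. h (U \<omega>))"
    using p(2) by (subst integrable_density) auto
  then have "integrable (distr M borel V) h"
    unfolding law' by (subst integrable_distr_eq) auto
  then show "integrable M (\<lambda>\<omega>. h (V \<omega>))"
    by (subst (asm) integrable_distr_eq) auto
  have "expectation (\<lambda>\<omega>. h (V \<omega>)) = integral\<^sup>L (distr M borel V) h"
    by (rule integral_distr[symmetric]) auto
  also have "\<dots> = expectation (\<lambda>\<omega>. (indicator A \<omega> / p) *\<^sub>R h (U \<omega>))"
    unfolding law' using p(2) by (subst integral_distr; (subst integral_density)?) auto
  also have "\<dots> = expectation (\<lambda>\<omega>. L \<omega> * h (U \<omega>) / p)"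
    by (intro Bochner_Integration.integral_cong) (use L(2) in \<open>auto simp: A_def indicator_def\<close>)
  also have "\<dots> = expectation (\<lambda>\<omega>. L \<omega> * h (U \<omega>)) / p" by simp
  finally show "expectation (\<lambda>\<omega>. L \<omega> * h (U \<omega>)) = p * expectation (\<lambda>\<omega>. h (V \<omega>))"
    using p(2) by simp
qed

text \<open>Only the law of \<open>V\<close> is known, so values of \<open>V\<close> can be confined to \<open>S\<close> only almost
  everywhere. This is how the integrality of \<open>U\<close> passes to its couplings.\<close>

lemma (in prob_space) AE_conditioned_copy:
  assumes L: "L \<in> borel_measurable M" "\<And>\<omega>. \<omega> \<in> space M \<Longrightarrow> L \<omega> \<in> {0, 1::real}"
    and [measurable]: "U \<in> borel_measurable M" "V \<in> borel_measurable M" "S \<in> sets borel"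
    and law: "distr M borel V = cond_law M U {\<omega> \<in> space M. L \<omega> = 1}"
    and S: "\<And>\<omega>. \<omega> \<in> space M \<Longrightarrow> U \<omega> \<in> S"
  shows "AE \<omega> in M. V \<omega> \<in> S"
proof -
  have [measurable]: "{\<omega> \<in> space M. L \<omega> = 1} \<in> sets M" using L(1) by measurable
  have "AE \<omega> in uniform_measure M {\<omega> \<in> space M. L \<omega> = 1}. U \<omega> \<in> S"
    using S by (intro AE_uniform_measureI) auto
  then have "AE y in distr M borel V. y \<in> S"
    unfolding law cond_law_def by (subst AE_distr_iff) auto
  then show ?thesis
    by (subst (asm) AE_distr_iff) auto
qed

text \<open>The contribution of one indicator \<open>L\<close> of mean \<open>p\<close>. The shift \<open>c\<close> is \<open>1\<close> for the indicators
  counted positively in \<open>U\<close> and \<open>-1\<close> for the others. If \<open>p = 0\<close>, nothing relates \<open>V\<close> to \<open>U\<close>, but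
  then \<open>L\<close> vanishes almost everywhere and both sides are zero.\<close>

lemma (in prob_space) coupling_bound:
  fixes F :: "int \<Rightarrow> real" and c :: int
  assumes L: "L \<in> borel_measurable M" "\<And>\<omega>. \<omega> \<in> space M \<Longrightarrow> L \<omega> \<in> {0, 1::real}"
    and p: "expectation L = p"
    and U [measurable]: "U \<in> borel_measurable M" and U_Ints: "\<And>\<omega>. \<omega> \<in> space M \<Longrightarrow> U \<omega> \<in> \<int>"
    and V [measurable]: "V \<in> borel_measurable M"
    and law: "p > 0 \<Longrightarrow> distr M borel (\<lambda>\<omega>. V \<omega> + of_int c) = cond_law M U {\<omega> \<in> space M. L \<omega> = 1}"
    and int: "\<And>b. integrable M (\<lambda>\<omega>. F \<lfloor>U \<omega> + of_int b\<rfloor>)"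
    and D: "\<And>j. ennreal \<bar>F (j + 1) - F j\<bar> \<le> D"
  shows "ennreal \<bar>p * expectation (\<lambda>\<omega>. F \<lfloor>U \<omega> + of_int c\<rfloor>) - expectation (\<lambda>\<omega>. L \<omega> * F \<lfloor>U \<omega>\<rfloor>)\<bar>
    \<le> D * (ennreal p * (\<integral>\<^sup>+\<omega>. ennreal \<bar>U \<omega> - V \<omega>\<bar> \<partial>M))"
proof (cases "p > 0")
  case False
  have nonneg: "AE \<omega> in M. 0 \<le> L \<omega>" using L(2) by (intro AE_I2) force
  then have "p = 0" using False integral_nonneg_AE[OF nonneg] p by auto
  have "integrable M L"
    by (rule integrable_const_bound[of _ 1]) (use L in \<open>auto, fastforce\<close>)
  then have "AE \<omega> in M. L \<omega> = 0"
    using integral_nonneg_eq_0_iff_AE[of M L] nonneg p \<open>p = 0\<close> by simp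
  then have "expectation (\<lambda>\<omega>. L \<omega> * F \<lfloor>U \<omega>\<rfloor>) = 0"
    by (intro integral_eq_zero_AE) auto
  then show ?thesis using \<open>p = 0\<close> by simp
next
  case True
  define g where "g y = F \<lfloor>y\<rfloor>" for y :: real
  have [measurable]: "g \<in> borel_measurable borel" unfolding g_def by measurable
  note law = law[OF True]
  have intV: "integrable M (\<lambda>\<omega>. g (V \<omega> + of_int c))"
    and EL: "expectation (\<lambda>\<omega>. L \<omega> * g (U \<omega>)) = p * expectation (\<lambda>\<omega>. g (V \<omega> + of_int c))"
    using expectation_against_indicator[OF L p True U _ law, of g] int[of 0] by (auto simp: g_def)
  have "AE \<omega> in M. V \<omega> + of_int c \<in> \<int>"
    by (rule AE_conditioned_copy[OF L _ _ _ law U_Ints]) auto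
  then have V_Ints: "AE \<omega> in M. V \<omega> \<in> \<int>"
    by eventually_elim (metis Ints_diff Ints_of_int add_diff_cancel_right')
  have "ennreal \<bar>p * expectation (\<lambda>\<omega>. g (U \<omega> + of_int c)) - expectation (\<lambda>\<omega>. L \<omega> * g (U \<omega>))\<bar>
      = ennreal p * ennreal (norm (expectation (\<lambda>\<omega>. g (U \<omega> + of_int c) - g (V \<omega> + of_int c))))"
  proof -
    have "expectation (\<lambda>\<omega>. g (U \<omega> + of_int c) - g (V \<omega> + of_int c))
        = expectation (\<lambda>\<omega>. g (U \<omega> + of_int c)) - expectation (\<lambda>\<omega>. g (V \<omega> + of_int c))"
      using int[of c] intV by (intro Bochner_Integration.integral_diff) (simp_all add: g_def)
    then show ?thesis
      using True by (simp add: EL abs_mult flip: ennreal_mult right_diff_distrib)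
  qed
  also have "\<dots> \<le> ennreal p * (\<integral>\<^sup>+\<omega>. ennreal \<bar>g (U \<omega> + of_int c) - g (V \<omega> + of_int c)\<bar> \<partial>M)"
    using int[of c] intV unfolding real_norm_def[symmetric]
    by (intro mult_left_mono integral_norm_bound_ennreal Bochner_Integration.integrable_diff)
      (simp_all add: g_def)
  also have "\<dots> \<le> ennreal p * (\<integral>\<^sup>+\<omega>. D * ennreal \<bar>U \<omega> - V \<omega>\<bar> \<partial>M)"
  proof (intro mult_left_mono nn_integral_mono_AE)
    show "AE \<omega> in M. ennreal \<bar>g (U \<omega> + of_int c) - g (V \<omega> + of_int c)\<bar> \<le> D * ennreal \<bar>U \<omega> - V \<omega>\<bar>"
      using V_Ints AE_space
    proof eventually_elim
      case (elim \<omega>)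
      then obtain a b where "U \<omega> = of_int a" "V \<omega> = of_int b"
        using U_Ints[of \<omega>] by (auto elim!: Ints_cases)
      then show ?case
        using increments_bound_differences[of F D "a + c" "b + c"] D
        by (simp add: g_def)
    qed
  qed simp
  also have "\<dots> = D * (ennreal p * (\<integral>\<^sup>+\<omega>. ennreal \<bar>U \<omega> - V \<omega>\<bar> \<partial>M))"
    by (simp add: nn_integral_cmult mult.left_commute)
  finally show ?thesis by (simp add: g_def)
qed

theorem theorem2:
  fixes P :: "'a measure" and Q :: "'b measure"
    and n m :: nat
    and L M :: "nat \<Rightarrow> 'a \<Rightarrow> real"
    and p q :: "nat \<Rightarrow> real"
    and U :: "'a \<Rightarrow> real"
    and UL UM :: "nat \<Rightarrow> 'a \<Rightarrow> real"
    and W :: "'b \<Rightarrow> real"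
    and l1 l2 :: real
    and f :: "real \<Rightarrow> int \<Rightarrow> real"
  assumes "prob_space P" and "prob_space Q"
    and "\<And>k. k \<in> {1..n} \<Longrightarrow> L k \<in> borel_measurable P"
    and "\<And>k \<omega>. k \<in> {1..n} \<Longrightarrow> \<omega> \<in> space P \<Longrightarrow> L k \<omega> \<in> {0, 1}"
    and "\<And>k. k \<in> {1..m} \<Longrightarrow> M k \<in> borel_measurable P"
    and "\<And>k \<omega>. k \<in> {1..m} \<Longrightarrow> \<omega> \<in> space P \<Longrightarrow> M k \<omega> \<in> {0, 1}"
    and "\<And>k. k \<in> {1..n} \<Longrightarrow> integral\<^sup>L P (L k) = p k"
    and "\<And>k. k \<in> {1..m} \<Longrightarrow> integral\<^sup>L P (M k) = q k"
    and "U = (\<lambda>\<omega>. (\<Sum>k=1..n. L k \<omega>) - (\<Sum>k=1..m. M k \<omega>))"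
    and "\<And>k. k \<in> {1..n} \<Longrightarrow> UL k \<in> borel_measurable P"
    and "\<And>k. k \<in> {1..m} \<Longrightarrow> UM k \<in> borel_measurable P"
    and "\<And>k. k \<in> {1..n} \<Longrightarrow> p k > 0 \<Longrightarrow>
           distr P borel (\<lambda>\<omega>. UL k \<omega> + 1) = cond_law P U {\<omega> \<in> space P. L k \<omega> = 1}"
    and "\<And>k. k \<in> {1..m} \<Longrightarrow> q k > 0 \<Longrightarrow>
           distr P borel (\<lambda>\<omega>. UM k \<omega> - 1) = cond_law P U {\<omega> \<in> space P. M k \<omega> = 1}"
    and "l1 = (\<Sum>k=1..n. p k)" and "l2 = (\<Sum>k=1..m. q k)"
    and "l1 > 0" and "l2 > 0"
    and "skellam_distributed Q W l1 l2"
    and "\<And>x k. l1 * f x (k + 1) - of_int k * f x k - l2 * f x (k - 1) =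
           (if of_int k \<le> x then 1 else 0) - measure Q {\<omega> \<in> space Q. W \<omega> \<le> x}"
  shows "ennreal (ks_dist P U Q W) \<le>
           diff_norm f *
             ((\<Sum>k=1..n. ennreal (p k) * (\<integral>\<^sup>+\<omega>. ennreal \<bar>U \<omega> - UL k \<omega>\<bar> \<partial>P)) +
              (\<Sum>k=1..m. ennreal (q k) * (\<integral>\<^sup>+\<omega>. ennreal \<bar>U \<omega> - UM k \<omega>\<bar> \<partial>P)))"
proof -
  interpret prob_space P by fact
  have L: "L k \<in> borel_measurable P" "\<And>\<omega>. \<omega> \<in> space P \<Longrightarrow> L k \<omega> \<in> {0, 1}"
    "expectation (L k) = p k" "UL k \<in> borel_measurable P"
    "p k > 0 \<Longrightarrow> distr P borel (\<lambda>\<omega>. UL k \<omega> + of_int 1) = cond_law P U {\<omega> \<in> space P. L k \<omega> = 1}"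
    if "k \<in> {1..n}" for k
    using assms that by auto
  have M: "M k \<in> borel_measurable P" "\<And>\<omega>. \<omega> \<in> space P \<Longrightarrow> M k \<omega> \<in> {0, 1}"
    "expectation (M k) = q k" "UM k \<in> borel_measurable P"
    "q k > 0 \<Longrightarrow> distr P borel (\<lambda>\<omega>. UM k \<omega> + of_int (-1)) = cond_law P U {\<omega> \<in> space P. M k \<omega> = 1}"
    if "k \<in> {1..m}" for k
    using assms that by auto
  note U_def = \<open>U = _\<close>
  have U [measurable]: "U \<in> borel_measurable P"
    unfolding U_def using L(1) M(1) by (intro borel_measurable_diff borel_measurable_sum) auto
  have U_range: "\<exists>u\<in>{- int m..int n}. U \<omega> = of_int u" if \<omega>: "\<omega> \<in> space P" for \<omega>
  proof -
    have 01: "\<exists>i\<in>{0..int N}. (\<Sum>k=1..N. X k) = of_int i"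
      if "\<And>k. k \<in> {1..N} \<Longrightarrow> X k \<in> {0, 1::real}" for N and X :: "nat \<Rightarrow> real"
    proof (intro bexI)
      have X: "X k = of_int \<lfloor>X k\<rfloor>" "\<lfloor>X k\<rfloor> \<in> {0..1}" if "k \<in> {1..N}" for k
        using \<open>\<And>k. k \<in> {1..N} \<Longrightarrow> X k \<in> {0, 1::real}\<close>[OF that] by auto
      show "(\<Sum>k=1..N. X k) = of_int (\<Sum>k=1..N. \<lfloor>X k\<rfloor>)"
        unfolding of_int_sum using X(1) by (intro sum.cong) auto
      show "(\<Sum>k=1..N. \<lfloor>X k\<rfloor>) \<in> {0..int N}"
        using X(2) sum_bounded_above[of "{1..N}" "\<lambda>k. \<lfloor>X k\<rfloor>" 1]
        by (auto intro!: sum_nonneg)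
    qed
    obtain i where i: "i \<in> {0..int n}" "(\<Sum>k=1..n. L k \<omega>) = of_int i"
      using 01[of n "\<lambda>k. L k \<omega>"] L(2) \<omega> by blast
    obtain j where j: "j \<in> {0..int m}" "(\<Sum>k=1..m. M k \<omega>) = of_int j"
      using 01[of m "\<lambda>k. M k \<omega>"] M(2) \<omega> by blast
    show ?thesis
      by (rule bexI[of _ "i - j"]) (use i j in \<open>auto simp: U_def\<close>)
  qed
  have U_Ints: "U \<omega> \<in> \<int>" if "\<omega> \<in> space P" for \<omega>
    using U_range[OF that] by auto
  \<comment> \<open>Every function of \<open>U\<close> is bounded, because \<open>U\<close> takes finitely many values.\<close>
  have integrable_U: "integrable P (\<lambda>\<omega>. G \<lfloor>U \<omega>\<rfloor>)" for G :: "int \<Rightarrow> real"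
  proof (rule integrable_const_bound)
    show "AE \<omega> in P. norm (G \<lfloor>U \<omega>\<rfloor>) \<le> (\<Sum>u\<in>{- int m..int n}. \<bar>G u\<bar>)"
    proof (rule AE_I2)
      fix \<omega> assume "\<omega> \<in> space P"
      then obtain u where "u \<in> {- int m..int n}" "U \<omega> = of_int u" using U_range by blast
      then show "norm (G \<lfloor>U \<omega>\<rfloor>) \<le> (\<Sum>u\<in>{- int m..int n}. \<bar>G u\<bar>)"
        using member_le_sum[of u "{- int m..int n}" "\<lambda>u. \<bar>G u\<bar>"] by simp
    qed
  qed measurable
  define R where "R = (\<Sum>k=1..n. ennreal (p k) * (\<integral>\<^sup>+\<omega>. ennreal \<bar>U \<omega> - UL k \<omega>\<bar> \<partial>P)) +
              (\<Sum>k=1..m. ennreal (q k) * (\<integral>\<^sup>+\<omega>. ennreal \<bar>U \<omega> - UM k \<omega>\<bar> \<partial>P))"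
  have pointwise: "ennreal \<bar>measure P {\<omega> \<in> space P. U \<omega> \<le> x} - measure Q {\<omega> \<in> space Q. W \<omega> \<le> x}\<bar>
      \<le> diff_norm f * R" for x
  proof -
    define w where "w = measure Q {\<omega> \<in> space Q. W \<omega> \<le> x}"
    define F where "F = f x"
    define a where "a k = p k * expectation (\<lambda>\<omega>. F \<lfloor>U \<omega> + of_int 1\<rfloor>) - expectation (\<lambda>\<omega>. L k \<omega> * F \<lfloor>U \<omega>\<rfloor>)" for k
    define b where "b k = q k * expectation (\<lambda>\<omega>. F \<lfloor>U \<omega> + of_int (-1)\<rfloor>) - expectation (\<lambda>\<omega>. M k \<omega> * F \<lfloor>U \<omega>\<rfloor>)" for k
    have D: "ennreal \<bar>F (j + 1) - F j\<bar> \<le> diff_norm f" for j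
      unfolding diff_norm_def F_def by (intro SUP_upper2[of x] SUP_upper2[of j]) auto
    have int: "integrable P (\<lambda>\<omega>. F \<lfloor>U \<omega> + of_int c\<rfloor>)" for c
      using integrable_U[of "\<lambda>u. F (u + c)"] by simp
    have a: "ennreal \<bar>a k\<bar> \<le> diff_norm f * (ennreal (p k) * (\<integral>\<^sup>+\<omega>. ennreal \<bar>U \<omega> - UL k \<omega>\<bar> \<partial>P))"
      if "k \<in> {1..n}" for k
      unfolding a_def by (rule coupling_bound) (use L[OF that] U U_Ints int D in auto)
    have b: "ennreal \<bar>b k\<bar> \<le> diff_norm f * (ennreal (q k) * (\<integral>\<^sup>+\<omega>. ennreal \<bar>U \<omega> - UM k \<omega>\<bar> \<partial>P))"
      if "k \<in> {1..m}" for k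
      unfolding b_def by (rule coupling_bound) (use M[OF that] U U_Ints int D in auto)
    have intL: "integrable P (\<lambda>\<omega>. L k \<omega> * F \<lfloor>U \<omega>\<rfloor>)" if "k \<in> {1..n}" for k
      by (rule Bochner_Integration.integrable_bound[OF integrable_U[of F]])
        (use L[OF that] in \<open>auto simp: abs_mult intro!: AE_I2 mult_left_le_one_le, fastforce+\<close>)
    have intM: "integrable P (\<lambda>\<omega>. M k \<omega> * F \<lfloor>U \<omega>\<rfloor>)" if "k \<in> {1..m}" for k
      by (rule Bochner_Integration.integrable_bound[OF integrable_U[of F]])
        (use M[OF that] in \<open>auto simp: abs_mult intro!: AE_I2 mult_left_le_one_le, fastforce+\<close>)
    \<comment> \<open>The Stein equation at the integer \<open>U \<omega>\<close>, with the factor \<open>U \<omega>\<close> split into its indicators.\<close>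
    have stein: "l1 * F (\<lfloor>U \<omega> + of_int 1\<rfloor>) - l2 * F (\<lfloor>U \<omega> + of_int (-1)\<rfloor>)
          - ((\<Sum>k=1..n. L k \<omega> * F \<lfloor>U \<omega>\<rfloor>) - (\<Sum>k=1..m. M k \<omega> * F \<lfloor>U \<omega>\<rfloor>))
        = indicator {\<omega> \<in> space P. U \<omega> \<le> x} \<omega> - w" if \<omega>: "\<omega> \<in> space P" for \<omega>
    proof -
      obtain u where u: "U \<omega> = of_int u" using U_range[OF \<omega>] by blast
      have "(\<Sum>k=1..n. L k \<omega> * F \<lfloor>U \<omega>\<rfloor>) - (\<Sum>k=1..m. M k \<omega> * F \<lfloor>U \<omega>\<rfloor>) = U \<omega> * F \<lfloor>U \<omega>\<rfloor>"
        by (simp add: U_def left_diff_distrib flip: sum_distrib_right)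
      then show ?thesis
        using assms(19)[of x u] \<omega>
        by (simp add: u F_def w_def indicator_def algebra_simps)
    qed
    have "integrable P (indicat_real {\<omega> \<in> space P. U \<omega> \<le> x})"
      by (intro integrable_real_indicator) (simp_all add: less_top[symmetric])
    then have "measure P {\<omega> \<in> space P. U \<omega> \<le> x} - w
        = expectation (\<lambda>\<omega>. indicator {\<omega> \<in> space P. U \<omega> \<le> x} \<omega> - w)"
      by (subst Bochner_Integration.integral_diff) (auto simp: prob_space)
    also have "\<dots> = expectation (\<lambda>\<omega>. l1 * F (\<lfloor>U \<omega> + of_int 1\<rfloor>) - l2 * F (\<lfloor>U \<omega> + of_int (-1)\<rfloor>)
          - ((\<Sum>k=1..n. L k \<omega> * F \<lfloor>U \<omega>\<rfloor>) - (\<Sum>k=1..m. M k \<omega> * F \<lfloor>U \<omega>\<rfloor>)))"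
      by (intro Bochner_Integration.integral_cong) (simp_all only: stein)
    also have "\<dots> = l1 * expectation (\<lambda>\<omega>. F (\<lfloor>U \<omega> + of_int 1\<rfloor>))
          - l2 * expectation (\<lambda>\<omega>. F (\<lfloor>U \<omega> + of_int (-1)\<rfloor>))
          - ((\<Sum>k=1..n. expectation (\<lambda>\<omega>. L k \<omega> * F \<lfloor>U \<omega>\<rfloor>)) - (\<Sum>k=1..m. expectation (\<lambda>\<omega>. M k \<omega> * F \<lfloor>U \<omega>\<rfloor>)))"
    proof -
      note [simp] = int[of 1, simplified] int[of "-1", simplified] intL intM
      have [simp]: "integrable P (\<lambda>\<omega>. \<Sum>k=1..n. L k \<omega> * F \<lfloor>U \<omega>\<rfloor>)"
        "integrable P (\<lambda>\<omega>. \<Sum>k=1..m. M k \<omega> * F \<lfloor>U \<omega>\<rfloor>)"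
        by (intro Bochner_Integration.integrable_sum; simp)+
      show ?thesis by (simp del: One_nat_def)
    qed
    also have "\<dots> = (\<Sum>k=1..n. a k) - (\<Sum>k=1..m. b k)"
      unfolding a_def b_def
      by (simp add: sum_subtractf assms(14,15) flip: sum_distrib_right)
    finally have "\<bar>measure P {\<omega> \<in> space P. U \<omega> \<le> x} - w\<bar> \<le> (\<Sum>k=1..n. \<bar>a k\<bar>) + (\<Sum>k=1..m. \<bar>b k\<bar>)"
      using sum_abs[of a "{1..n}"] sum_abs[of b "{1..m}"] by linarith
    then have "ennreal \<bar>measure P {\<omega> \<in> space P. U \<omega> \<le> x} - w\<bar>
        \<le> (\<Sum>k=1..n. ennreal \<bar>a k\<bar>) + (\<Sum>k=1..m. ennreal \<bar>b k\<bar>)"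
      by (simp add: sum_nonneg flip: ennreal_plus)
    also have "\<dots> \<le> diff_norm f * R"
      unfolding R_def distrib_left sum_distrib_left by (intro add_mono sum_mono a b)
    finally show ?thesis unfolding w_def .
  qed
  show ?thesis
    unfolding R_def[symmetric]
  proof (cases "diff_norm f * R" rule: ennreal_cases)
    case (real r)
    then have "ks_dist P U Q W \<le> r"
      unfolding ks_dist_def using pointwise by (intro cSUP_least) (simp_all add: real)
    then show "ennreal (ks_dist P U Q W) \<le> diff_norm f * R"
      unfolding real(2) by (rule ennreal_leI)
  qed simp
qed

end
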